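(* Let $1\le p\le\infty$, $\varphi\in\ell^\infty(\mathbb{Z})$, $\psi\in\ell^\infty(\mathbb{N})$, and assume that the matrix $A:=T(\varphi)+H(\psi)$ generates a compact operator on $\ell^p(\mathbb{N}_0)$. Then $T(\varphi)$ is a checkerboard matrix and $\psi=\psi_1+\psi_2$, where $H(\psi_1)$ is a compact Hankel matrix (i.e. generates a compact operator on $\ell^p(\mathbb{N}_0)$) with $\psi_1\in c_0(\mathbb{N})$ and $H(\psi_2)=-T(\varphi)$. Moreover, the decomposition of $\psi$ is unique.
   Context: $\mathbb{N}=\{1,2,\dots\}$, $\mathbb{N}_0=\{0,1,2,\dots\}$. An infinite matrix $(A_{j,k})_{j,k\in\mathbb{N}_0}$ generates a bounded linear operator on $\ell^p(\mathbb{N}_0)$ if there is $c>0$ such that for each $x\in\ell^p(\mathbb{N}_0)$ the sequence $y_j=\sum_{k}A_{j,k}x_k$ is in $\ell^p(\mathbb{N}_0)$ and $\|y\|\le c\|x\|$; it generates a compact operator if in addition the resulting operator is compact. For sequences $\varphi=(\varphi_n)_{n\in\mathbb{Z}}$ and $\psi=(\psi_n)_{n\in\mathbb{N}}$: $T(\varphi)=(\varphi_{j-k})_{j,k\in\mathbb{N}_0}$ (Toeplitz matrix), $H(\psi)=(\psi_{j+k+1})_{j,k\in\mathbb{N}_0}$ (Hankel matrix). A matrix $(C_{j,k})_{j,k\in\mathbb{N}_0}$ is a checkerboard matrix if $C_{j,k}=C_{j+1,k+1}$ for all $j,k\in\mathbb{N}_0$ and $C_{j,k}=C_{j+1,k-1}$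 for all $j\in\mathbb{N}_0$, $k\in\mathbb{N}$. $c_0(\mathbb{N})$ is the space of sequences tending to $0$. *)

theory Defs
  imports "HOL-Analysis.Analysis"
begin

section \<open>The sequence spaces \<open>\<ell>\<^sup>p(\<nat>\<^sub>0)\<close>\<close>

definition lp_space :: "ereal \<Rightarrow> (nat \<Rightarrow> complex) set" where
  "lp_space p = {x. if p = \<infinity> then bounded (range x)
                    else summable (\<lambda>n. norm (x n) powr real_of_ereal p)}"

text \<open>The value 0 outside the space is a convention only; it makes \<open>lp_dist\<close> nonnegative
  for all arguments, as the locale \<^locale>\<open>Metric_space\<close> requires.\<close>

definition lp_norm :: "ereal \<Rightarrow> (nat \<Rightarrow> complex) \<Rightarrow> real" where
  "lp_norm p x = (if x \<notin> lp_space p then 0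
                  else if p = \<infinity> then (SUP n. norm (x n))
                  else (\<Sum>n. norm (x n) powr real_of_ereal p) powr (1 / real_of_ereal p))"

definition lp_dist :: "ereal \<Rightarrow> (nat \<Rightarrow> complex) \<Rightarrow> (nat \<Rightarrow> complex) \<Rightarrow> real" where
  "lp_dist p x y = lp_norm p (\<lambda>n. x n - y n)"

abbreviation lp_topology :: "ereal \<Rightarrow> (nat \<Rightarrow> complex) topology" where
  "lp_topology p \<equiv> Metric_space.mtopology (lp_space p) (lp_dist p)"

lemma powr_convex_nonneg:
  fixes u v t q :: real
  assumes q: "1 \<le> q" and u: "0 \<le> u" and v: "0 \<le> v" and t: "0 \<le> t" "t \<le> 1"
  shows "(t * u + (1 - t) * v) powr q \<le> t * u powr q + (1 - t) * v powr q"
proof -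
  have shrink: "(s * w) powr q \<le> s * w powr q" if "0 \<le> s" "s \<le> 1" "0 \<le> w" for s w :: real
  proof -
    have "s powr q \<le> s"
    proof (cases "s = 0")
      case False
      then have "s powr q \<le> s powr 1"
        using that q by (intro powr_mono') auto
      then show ?thesis using that False by simp
    qed auto
    then show ?thesis
      using that by (simp add: powr_mult mult_right_mono)
  qed
  consider "u = 0" | "v = 0" | "0 < u" "0 < v" using u v by linarith
  then show ?thesis
  proof cases
    case 1 then show ?thesis using shrink[of "1 - t" v] t v by simp
  next
    case 2 then show ?thesis using shrink[of t u] t u by simp
  next
    case 3
    then show ?thesis
      using convex_onD[OF powr_convex[OF q], of "1 - t" u v] t by simp
  qed
qed

lemma lp_space_infinity: "x \<in> lp_space \<infinity> \<longleftrightarrow> bounded (range x)"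
  by (simp add: lp_space_def)

lemma lp_space_finite:
  "p \<noteq> \<infinity> \<Longrightarrow> x \<in> lp_space p \<longleftrightarrow> summable (\<lambda>n. norm (x n) powr real_of_ereal p)"
  by (simp add: lp_space_def)

lemma bdd_above_norm_range:
  fixes x :: "nat \<Rightarrow> complex"
  assumes "bounded (range x)"
  shows "bdd_above (range (\<lambda>n. norm (x n)))"
  using assms by (auto simp: bounded_iff bdd_above_def)

lemma lp_norm_nonneg: "0 \<le> lp_norm p x"
proof (cases "p = \<infinity> \<and> x \<in> lp_space p")
  case True
  then have "norm (x 0) \<le> (SUP n. norm (x n))"
    by (intro cSUP_upper bdd_above_norm_range) (auto simp: lp_space_infinity)
  then have "0 \<le> (SUP n. norm (x n))"
    using norm_ge_zero[of "x 0"] by linarith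
  with True show ?thesis by (simp add: lp_norm_def)
qed (auto simp: lp_norm_def)

lemma lp_norm_uminus: "lp_norm p (\<lambda>n. - x n) = lp_norm p x"
proof -
  have "(\<lambda>n. - x n) \<in> lp_space p \<longleftrightarrow> x \<in> lp_space p"
    by (auto simp: lp_space_def bounded_iff)
  then show ?thesis by (simp add: lp_norm_def)
qed

lemma lp_norm_powr:
  assumes "1 \<le> p" "p \<noteq> \<infinity>" "x \<in> lp_space p"
  shows "lp_norm p x powr real_of_ereal p = (\<Sum>n. norm (x n) powr real_of_ereal p)"
proof -
  have "real_of_ereal p \<ge> 1" using assms by (cases p) auto
  moreover have "0 \<le> (\<Sum>n. norm (x n) powr real_of_ereal p)"
    using assms by (intro suminf_nonneg) (auto simp: lp_space_finite)
  ultimately show ?thesis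
    using assms by (simp add: lp_norm_def powr_powr)
qed

lemma lp_norm_eq_0_iff:
  assumes "1 \<le> p" "x \<in> lp_space p"
  shows "lp_norm p x = 0 \<longleftrightarrow> x = (\<lambda>n. 0)"
proof (cases "p = \<infinity>")
  case True
  have "norm (x n) \<le> (SUP n. norm (x n))" for n
    using assms True by (intro cSUP_upper bdd_above_norm_range) (auto simp: lp_space_infinity)
  then show ?thesis
    using True assms by (auto simp: lp_norm_def fun_eq_iff)
next
  case False
  have "lp_norm p x = 0 \<longleftrightarrow> (\<Sum>n. norm (x n) powr real_of_ereal p) = 0"
    using assms False by (simp add: lp_norm_def)
  also have "\<dots> \<longleftrightarrow> (\<forall>n. norm (x n) powr real_of_ereal p = 0)"
    using assms False by (intro suminf_eq_zero_iff) (auto simp: lp_space_finite)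
  finally show ?thesis by (auto simp: fun_eq_iff)
qed

lemma lp_add:
  assumes p: "1 \<le> p" and x: "x \<in> lp_space p" and y: "y \<in> lp_space p"
  shows "(\<lambda>n. x n + y n) \<in> lp_space p"
    and "lp_norm p (\<lambda>n. x n + y n) \<le> lp_norm p x + lp_norm p y"
proof -
  have "(\<lambda>n. x n + y n) \<in> lp_space p \<and>
        lp_norm p (\<lambda>n. x n + y n) \<le> lp_norm p x + lp_norm p y"
  proof (cases "p = \<infinity>")
    case True
    have le: "norm (z n) \<le> lp_norm p z" if "z \<in> lp_space p" for z n
    proof -
      have "norm (z n) \<le> (SUP n. norm (z n))"
        using that True by (intro cSUP_upper bdd_above_norm_range) (auto simp: lp_space_infinity)
      then show ?thesis using that True by (simp add: lp_norm_def)
    qed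
    have *: "norm (x n + y n) \<le> lp_norm p x + lp_norm p y" for n
      using norm_triangle_ineq[of "x n" "y n"] le[OF x, of n] le[OF y, of n] by linarith
    then have "(\<lambda>n. x n + y n) \<in> lp_space p"
      using True by (auto simp: lp_space_infinity bounded_iff)
    moreover have "(SUP n. norm (x n + y n)) \<le> lp_norm p x + lp_norm p y"
      using * by (intro cSUP_least) auto
    ultimately show ?thesis using True by (simp add: lp_norm_def)
  next
    case False
    define q where "q = real_of_ereal p"
    have q: "q \<ge> 1" using p False by (cases p) (auto simp: q_def)
    define a b where "a = lp_norm p x" and "b = lp_norm p y"
    have ab: "0 \<le> a" "0 \<le> b" by (simp_all add: a_def b_def lp_norm_nonneg)
    show ?thesis
    proof (cases "a = 0 \<or> b = 0")
      case True
      then have "x = (\<lambda>n. 0) \<or> y = (\<lambda>n. 0)"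
        using lp_norm_eq_0_iff[OF p x] lp_norm_eq_0_iff[OF p y] by (auto simp: a_def b_def)
      then show ?thesis
        using x y lp_norm_nonneg[of p] by auto
    next
      case False
      then have pos: "0 < a" "0 < b" using ab by auto
      define t where "t = a / (a + b)"
      have t: "0 \<le> t" "t \<le> 1" using pos by (auto simp: t_def)
      have sx: "summable (\<lambda>n. norm (x n) powr q)" and sy: "summable (\<lambda>n. norm (y n) powr q)"
        using x y \<open>p \<noteq> \<infinity>\<close> by (auto simp: lp_space_finite q_def)
      define g where "g n = (a + b) powr q *
        (t * (norm (x n) powr q / a powr q) + (1 - t) * (norm (y n) powr q / b powr q))" for n
      have bound: "norm (x n + y n) powr q \<le> g n" for n
      proof -
        have "(a + b) * (t * (norm (x n) / a) + (1 - t) * (norm (y n) / b)) = norm (x n) + norm (y n)"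
        proof -
          have "(a + b) * t = a" "(a + b) * (1 - t) = b"
            using pos by (simp_all add: t_def field_simps)
          then have "(a + b) * t * (norm (x n) / a) = norm (x n)"
            "(a + b) * (1 - t) * (norm (y n) / b) = norm (y n)" using pos by simp_all
          then show ?thesis by (simp only: distrib_left mult.assoc[symmetric])
        qed
        then have "norm (x n + y n) powr q
            \<le> ((a + b) * (t * (norm (x n) / a) + (1 - t) * (norm (y n) / b))) powr q"
          using norm_triangle_ineq[of "x n" "y n"] q by (intro powr_mono2) auto
        also have "\<dots> = (a + b) powr q * (t * (norm (x n) / a) + (1 - t) * (norm (y n) / b)) powr q"
          using pos t by (intro powr_mult)
        also have "\<dots> \<le> (a + b) powr q *
            (t * (norm (x n) / a) powr q + (1 - t) * (norm (y n) / b) powr q)"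
          using pos t q by (intro mult_left_mono powr_convex_nonneg) auto
        also have "\<dots> = g n"
          using pos by (simp add: g_def powr_divide)
        finally show ?thesis .
      qed
      have na: "(\<Sum>n. norm (x n) powr q) = a powr q" and nb: "(\<Sum>n. norm (y n) powr q) = b powr q"
        using lp_norm_powr[OF p \<open>p \<noteq> \<infinity>\<close> x] lp_norm_powr[OF p \<open>p \<noteq> \<infinity>\<close> y]
        by (simp_all add: a_def b_def q_def)
      have "g sums ((a + b) powr q * (t * (a powr q / a powr q) + (1 - t) * (b powr q / b powr q)))"
        unfolding g_def using summable_sums[OF sx] summable_sums[OF sy] unfolding na nb
        by (intro sums_mult sums_add sums_divide)
      then have g: "g sums ((a + b) powr q)" using pos by simp
      have s: "summable (\<lambda>n. norm (x n + y n) powr q)"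
        by (rule summable_comparison_test'[OF sums_summable[OF g]]) (use bound in simp)
      then have mem: "(\<lambda>n. x n + y n) \<in> lp_space p"
        using \<open>p \<noteq> \<infinity>\<close> by (simp add: lp_space_finite q_def)
      have "(\<Sum>n. norm (x n + y n) powr q) \<le> (a + b) powr q"
        using suminf_le[OF bound s sums_summable[OF g]] sums_unique[OF g] by simp
      then have "(\<Sum>n. norm (x n + y n) powr q) powr (1 / q) \<le> ((a + b) powr q) powr (1 / q)"
        using q by (intro powr_mono2 suminf_nonneg s) auto
      also have "\<dots> = a + b" using pos q by (simp add: powr_powr)
      finally show ?thesis
        using mem \<open>p \<noteq> \<infinity>\<close> by (simp add: lp_norm_def a_def b_def q_def)
    qed
  qed
  then show "(\<lambda>n. x n + y n) \<in> lp_space p"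
    and "lp_norm p (\<lambda>n. x n + y n) \<le> lp_norm p x + lp_norm p y" by auto
qed

lemma lp_diff:
  assumes "1 \<le> p" "x \<in> lp_space p" "y \<in> lp_space p"
  shows "(\<lambda>n. x n - y n) \<in> lp_space p"
proof -
  have "(\<lambda>n. - y n) \<in> lp_space p"
    using assms by (auto simp: lp_space_def bounded_iff)
  from lp_add(1)[OF assms(1,2) this] show ?thesis by simp
qed

lemma Metric_space_lp:
  assumes p: "1 \<le> p"
  shows "Metric_space (lp_space p) (lp_dist p)"
proof
  show "0 \<le> lp_dist p x y" for x y
    by (simp add: lp_dist_def lp_norm_nonneg)
  show "lp_dist p x y = lp_dist p y x" for x y
    using lp_norm_uminus[of p "\<lambda>n. x n - y n"] by (simp add: lp_dist_def)
  show "lp_dist p x y = 0 \<longleftrightarrow> x = y" if "x \<in> lp_space p" "y \<in> lp_space p" for x y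
    using lp_norm_eq_0_iff[OF p lp_diff[OF p that]] by (simp add: lp_dist_def fun_eq_iff)
  show "lp_dist p x z \<le> lp_dist p x y + lp_dist p y z"
    if "x \<in> lp_space p" "y \<in> lp_space p" "z \<in> lp_space p" for x y z
    using lp_add(2)[OF p lp_diff[OF p that(1,2)] lp_diff[OF p that(2,3)]]
    by (simp add: lp_dist_def)
qed


section \<open>Operators generated by infinite matrices\<close>

type_synonym inf_matrix = "nat \<Rightarrow> nat \<Rightarrow> complex"

definition mat_apply :: "inf_matrix \<Rightarrow> (nat \<Rightarrow> complex) \<Rightarrow> (nat \<Rightarrow> complex)" where
  "mat_apply A x = (\<lambda>j. \<Sum>k. A j k * x k)"

definition generates_bounded :: "ereal \<Rightarrow> inf_matrix \<Rightarrow> bool" where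
  "generates_bounded p A \<longleftrightarrow>
     (\<exists>c>0. \<forall>x\<in>lp_space p.
        (\<forall>j. summable (\<lambda>k. A j k * x k)) \<and>
        mat_apply A x \<in> lp_space p \<and>
        lp_norm p (mat_apply A x) \<le> c * lp_norm p x)"

text \<open>Compactness: the image of the closed unit ball is relatively compact.\<close>

definition generates_compact :: "ereal \<Rightarrow> inf_matrix \<Rightarrow> bool" where
  "generates_compact p A \<longleftrightarrow>
     generates_bounded p A \<and>
     compactin (lp_topology p)
       (lp_topology p closure_of (mat_apply A ` {x \<in> lp_space p. lp_norm p x \<le> 1}))"


section \<open>Toeplitz, Hankel and checkerboard matrices\<close>

definition toeplitz :: "(int \<Rightarrow> complex) \<Rightarrow> inf_matrix" where
  "toeplitz \<phi> j k = \<phi> (int j - int k)"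

text \<open>A sequence \<open>(\<psi>\<^sub>n)\<close> indexed by \<open>n = 1, 2, \<dots>\<close> is a function on \<^typ>\<open>nat\<close> whose value
  at \<open>0\<close> is irrelevant.\<close>

definition hankel :: "(nat \<Rightarrow> complex) \<Rightarrow> inf_matrix" where
  "hankel \<psi> j k = \<psi> (j + k + 1)"

definition checkerboard :: "inf_matrix \<Rightarrow> bool" where
  "checkerboard C \<longleftrightarrow>
     (\<forall>j k. C j k = C (j + 1) (k + 1)) \<and>
     (\<forall>j. \<forall>k\<ge>1. C j k = C (j + 1) (k - 1))"

definition compact_checkerboard_decomp ::
  "ereal \<Rightarrow> (int \<Rightarrow> complex) \<Rightarrow> (nat \<Rightarrow> complex) \<Rightarrow> (nat \<Rightarrow> complex) \<Rightarrow> (nat \<Rightarrow> complex) \<Rightarrow> bool" where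
  "compact_checkerboard_decomp p \<phi> \<psi> \<psi>1 \<psi>2 \<longleftrightarrow>
     (\<forall>n\<ge>1. \<psi> n = \<psi>1 n + \<psi>2 n) \<and>
     generates_compact p (hankel \<psi>1) \<and>
     \<psi>1 \<longlonglongrightarrow> 0 \<and>
     hankel \<psi>2 = (\<lambda>j k. - toeplitz \<phi> j k)"

end

theory Submission
  imports Defs
begin

text \<open>
  Compactness forces every diagonal of \<open>A = T(\<phi>) + H(\<psi>)\<close> to tend to \<open>0\<close>. The columns
  \<open>A e\<^sub>k\<close> lie in a relatively compact set, so a subsequence of them converges in
  \<open>\<ell>\<^sup>p\<close> to some \<open>v\<close>, and the entry of the column \<open>A e\<^sub>k\<close> in row \<open>k + n\<close> differs from
  \<open>v\<^bsub>k+n\<^esub>\<close> by at most the distance of \<open>A e\<^sub>k\<close> from \<open>v\<close>. For \<open>p < \<infinity>\<close> the sequence \<open>v\<close> tends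
  to \<open>0\<close> because it is in \<open>\<ell>\<^sup>p\<close>. For \<open>p = \<infinity>\<close> the rows of \<open>A\<close> are summable, hence tend to
  \<open>0\<close>, and so \<open>v = 0\<close>. This is lemma \<open>compact_entries_tendsto_0\<close>.

  Now compare the diagonals of \<open>A\<close> that start at \<open>(j, k)\<close> and at \<open>(j + 1, k - 1)\<close>. Their
  \<open>m\<close>-th entries are \<open>\<phi>\<^bsub>j-k\<^esub> + \<psi>\<^bsub>j+k+2m+1\<^esub>\<close> and \<open>\<phi>\<^bsub>j-k+2\<^esub> + \<psi>\<^bsub>j+k+2m+1\<^esub>\<close>, with the same
  Hankel part. Both tend to \<open>0\<close>, so \<open>\<phi>\<^bsub>j-k\<^esub> = \<phi>\<^bsub>j-k+2\<^esub>\<close>: the sequence \<open>\<phi>\<close> has period 2 and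
  \<open>T(\<phi>)\<close> is a checkerboard. A checkerboard is also a Hankel matrix, namely \<open>-H(\<psi>\<^sub>2)\<close> with
  \<open>\<psi>\<^sub>2(n) = -\<phi>\<^bsub>n-1\<^esub>\<close>, and then \<open>H(\<psi> - \<psi>\<^sub>2) = A\<close> is compact. The first column determines
  the symbol of a Hankel matrix, which gives uniqueness.
\<close>

section \<open>Coordinates in sequence spaces\<close>

lemma norm_le_lp_norm:
  assumes "1 \<le> p" "x \<in> lp_space p"
  shows "norm (x n) \<le> lp_norm p x"
proof (cases "p = \<infinity>")
  case True
  then have "norm (x n) \<le> (SUP n. norm (x n))"
    using assms by (intro cSUP_upper bdd_above_norm_range) (auto simp: lp_space_infinity)
  then show ?thesis using True assms by (simp add: lp_norm_def)
next
  case False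
  define q where "q = real_of_ereal p"
  have q: "1 \<le> q" using assms False by (cases p) (auto simp: q_def)
  have s: "summable (\<lambda>n. norm (x n) powr q)"
    using assms False by (simp add: lp_space_finite q_def)
  have "norm (x n) powr q \<le> (\<Sum>n. norm (x n) powr q)"
    using sum_le_suminf[OF s, of "{n}"] by simp
  also have "\<dots> = lp_norm p x powr q"
    using lp_norm_powr[OF assms(1) False assms(2)] by (simp add: q_def)
  finally show ?thesis
    using q lp_norm_nonneg[of p x] powr_less_mono2[of q "lp_norm p x" "norm (x n)"] by force
qed

lemma lp_space_tendsto_0:
  assumes "1 \<le> p" "p \<noteq> \<infinity>" "x \<in> lp_space p"
  shows "x \<longlonglongrightarrow> 0"
proof -
  define q where "q = real_of_ereal p"
  have q: "1 \<le> q" using assms by (cases p) (auto simp: q_def)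
  have "(\<lambda>n. norm (x n) powr q) \<longlonglongrightarrow> 0"
    using assms by (intro summable_LIMSEQ_zero) (simp add: lp_space_finite q_def)
  from tendsto_powr2[OF this tendsto_const, of "1 / q"]
  have "(\<lambda>n. (norm (x n) powr q) powr (1 / q)) \<longlonglongrightarrow> 0 powr (1 / q)"
    using q by simp
  then show ?thesis
    using q by (simp add: powr_powr tendsto_norm_zero_iff)
qed

definition unit_seq :: "nat \<Rightarrow> nat \<Rightarrow> complex" where
  "unit_seq k = (\<lambda>n. if n = k then 1 else 0)"

lemma unit_seq_lp:
  assumes "1 \<le> p"
  shows "unit_seq k \<in> lp_space p" "lp_norm p (unit_seq k) \<le> 1"
proof -
  have powr: "norm (unit_seq k n) powr q = (if n = k then 1 else 0)" for n and q :: real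
    by (simp add: unit_seq_def)
  show mem: "unit_seq k \<in> lp_space p"
  proof (cases "p = \<infinity>")
    case True
    then show ?thesis
      by (auto simp: lp_space_infinity bounded_iff unit_seq_def intro!: exI[of _ 1])
  next
    case False
    then show ?thesis
      by (simp add: lp_space_finite powr)
  qed
  show "lp_norm p (unit_seq k) \<le> 1"
  proof (cases "p = \<infinity>")
    case True
    then show ?thesis
      using mem by (auto simp: lp_norm_def unit_seq_def intro!: cSUP_least)
  next
    case False
    have "(\<lambda>n. if n = k then 1 else 0 :: real) sums 1"
      using sums_single[of k "\<lambda>_. 1 :: real"] by simp
    then show ?thesis
      using mem False by (simp add: lp_norm_def powr sums_iff)
  qed
qed

lemma mat_apply_unit_seq: "mat_apply A (unit_seq k) = (\<lambda>j. A j k)"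
proof
  fix j
  have "(\<lambda>i. A j i * unit_seq k i) = (\<lambda>i. if i = k then A j i else 0)"
    by (auto simp: unit_seq_def)
  then show "mat_apply A (unit_seq k) j = A j k"
    using sums_single[of k "A j"] by (simp add: mat_apply_def sums_iff)
qed

section \<open>Entries of bounded and compact matrices\<close>

lemma generates_boundedD:
  assumes "generates_bounded p A" "x \<in> lp_space p"
  shows "summable (\<lambda>k. A j k * x k)" "mat_apply A x \<in> lp_space p"
proof -
  from assms(1) obtain c where "\<forall>x\<in>lp_space p.
        (\<forall>j. summable (\<lambda>k. A j k * x k)) \<and>
        mat_apply A x \<in> lp_space p \<and>
        lp_norm p (mat_apply A x) \<le> c * lp_norm p x"
    unfolding generates_bounded_def by (elim exE conjE)
  from bspec[OF this assms(2)]
  show "summable (\<lambda>k. A j k * x k)" "mat_apply A x \<in> lp_space p" by simp_all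
qed

lemma bounded_column_in_lp:
  assumes "1 \<le> p" "generates_bounded p A"
  shows "(\<lambda>j. A j k) \<in> lp_space p"
proof -
  have "mat_apply A (unit_seq k) \<in> lp_space p"
    using assms(2) unit_seq_lp(1)[OF assms(1)] by (rule generates_boundedD)
  then show ?thesis by (simp only: mat_apply_unit_seq)
qed

text \<open>The constant sequence \<open>1\<close> lies in \<open>\<ell>\<^sup>\<infinity>\<close>, and applying the matrix to it sums the rows.\<close>

lemma bounded_infinity_row_tendsto_0:
  assumes "generates_bounded \<infinity> A"
  shows "(\<lambda>k. A j k) \<longlonglongrightarrow> 0"
proof -
  have "(\<lambda>_. 1) \<in> lp_space \<infinity>" by (simp add: lp_space_infinity)
  from summable_LIMSEQ_zero[OF generates_boundedD(1)[OF assms this, of j]] show ?thesis by simp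
qed

text \<open>The columns are the images of the unit sequences, which lie in the closed unit ball.\<close>

lemma compact_columns_convergent_subseq:
  fixes g :: "nat \<Rightarrow> nat"
  assumes p: "1 \<le> p" and A: "generates_compact p A"
  obtains v s where "v \<in> lp_space p" "strict_mono s"
    "(\<lambda>i. lp_dist p (\<lambda>j. A j (g (s i))) v) \<longlonglongrightarrow> 0"
proof -
  interpret Metric_space "lp_space p" "lp_dist p" by (rule Metric_space_lp[OF p])
  let ?I = "mat_apply A ` {x \<in> lp_space p. lp_norm p x \<le> 1}"
  have "generates_bounded p A"
    using A by (simp add: generates_compact_def)
  from generates_boundedD(2)[OF this] have "?I \<subseteq> topspace mtopology"
    by auto
  then have sub: "?I \<subseteq> mtopology closure_of ?I"
    by (rule closure_of_subset)
  have "mat_apply A (unit_seq k) \<in> ?I" for k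
    using unit_seq_lp[OF p, of k] by (intro imageI) simp
  then have "(\<lambda>j. A j k) \<in> ?I" for k
    by (simp only: mat_apply_unit_seq)
  then have range: "range (\<lambda>i j. A j (g i)) \<subseteq> mtopology closure_of ?I"
    using sub by blast
  have "compactin mtopology (mtopology closure_of ?I)"
    using A by (simp add: generates_compact_def)
  then have "\<forall>\<sigma> :: nat \<Rightarrow> nat \<Rightarrow> complex. range \<sigma> \<subseteq> mtopology closure_of ?I \<longrightarrow>
      (\<exists>v s. v \<in> mtopology closure_of ?I \<and> strict_mono s \<and>
        limitin mtopology (\<sigma> \<circ> s) v sequentially)"
    unfolding compactin_sequentially by (rule conjunct2)
  from this[THEN spec, THEN mp, OF range]
  obtain v s where "strict_mono s" and
    "limitin mtopology ((\<lambda>i j. A j (g i)) \<circ> s) v sequentially"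
    by (elim exE conjE)
  with that[of v s] show ?thesis
    by (simp add: limitin_metric_dist_null o_def)
qed

text \<open>Along the subsequence the columns approach their limit \<open>v\<close> uniformly in the row index, so
  the entries behave like \<open>v\<close> at row indices tending to infinity. It remains to see that \<open>v\<close>
  tends to \<open>0\<close>: for \<open>p < \<infinity>\<close> any element of \<open>\<ell>\<^sup>p\<close> does, and for \<open>p = \<infinity>\<close> each coordinate of \<open>v\<close>
  is the limit of a row. The latter uses that the column indices tend to infinity too.\<close>

lemma compact_entries_subseq_tendsto_0:
  assumes p: "1 \<le> p" and A: "generates_compact p A"
    and f: "filterlim f at_top sequentially" and g: "filterlim g at_top sequentially"
  obtains s where "strict_mono s" "(\<lambda>i. A (f (s i)) (g (s i))) \<longlonglongrightarrow> 0"
proof -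
  obtain v s where v: "v \<in> lp_space p" and s: "strict_mono s"
    and lim: "(\<lambda>i. lp_dist p (\<lambda>j. A j (g (s i))) v) \<longlonglongrightarrow> 0"
    by (rule compact_columns_convergent_subseq[OF p A])
  have bdd: "generates_bounded p A"
    using A by (simp add: generates_compact_def)
  have coord: "norm (A j (g (s i)) - v j) \<le> lp_dist p (\<lambda>j. A j (g (s i))) v" for i j
    unfolding lp_dist_def
    by (rule norm_le_lp_norm[OF p lp_diff[OF p bounded_column_in_lp[OF p bdd] v]])
  have fs: "filterlim (\<lambda>i. f (s i)) at_top sequentially"
    and gs: "filterlim (\<lambda>i. g (s i)) at_top sequentially"
    using filterlim_compose[OF f filterlim_subseq[OF s]]
      filterlim_compose[OF g filterlim_subseq[OF s]] by simp_all
  have "v \<longlonglongrightarrow> 0"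
  proof (cases "p = \<infinity>")
    case True
    have "v j = 0" for j
    proof (rule LIMSEQ_unique)
      have "(\<lambda>i. A j (g (s i)) - v j) \<longlonglongrightarrow> 0"
        using coord by (intro Lim_null_comparison[OF _ lim] always_eventually) simp
      then show "(\<lambda>i. A j (g (s i))) \<longlonglongrightarrow> v j" by (simp add: LIM_zero_iff)
      show "(\<lambda>i. A j (g (s i))) \<longlonglongrightarrow> 0"
        using filterlim_compose[OF bounded_infinity_row_tendsto_0 gs] bdd True by simp
    qed
    then have "v = (\<lambda>_. 0)" by (simp add: fun_eq_iff)
    then show ?thesis by simp
  next
    case False
    then show ?thesis using lp_space_tendsto_0[OF p _ v] by simp
  qed
  then have "(\<lambda>i. v (f (s i))) \<longlonglongrightarrow> 0"
    using fs by (rule filterlim_compose)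
  moreover have "(\<lambda>i. A (f (s i)) (g (s i)) - v (f (s i))) \<longlonglongrightarrow> 0"
    using coord by (intro Lim_null_comparison[OF _ lim] always_eventually) simp
  ultimately have "(\<lambda>i. v (f (s i)) + (A (f (s i)) (g (s i)) - v (f (s i)))) \<longlonglongrightarrow> 0 + 0"
    by (rule tendsto_add)
  then have "(\<lambda>i. A (f (s i)) (g (s i))) \<longlonglongrightarrow> 0"
    by simp
  with s show ?thesis by (rule that)
qed

text \<open>Every subsequence of the entries has a further subsequence tending to \<open>0\<close>, because
  compactness applies to the rows and columns picked out by the subsequence; hence the whole
  sequence of entries tends to \<open>0\<close>.\<close>

lemma compact_entries_tendsto_0:
  assumes p: "1 \<le> p" and A: "generates_compact p A"
    and f: "filterlim f at_top sequentially" and g: "filterlim g at_top sequentially"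
  shows "(\<lambda>i. A (f i) (g i)) \<longlonglongrightarrow> 0"
proof (rule ccontr)
  assume "\<not> ?thesis"
  then obtain e where e: "e > 0" "\<not> (\<forall>\<^sub>F i in sequentially. norm (A (f i) (g i)) < e)"
    by (auto simp: tendsto_iff)
  then have "infinite {i. \<not> norm (A (f i) (g i)) < e}"
    by (simp add: cofinite_eq_sequentially[symmetric] eventually_cofinite)
  then obtain r :: "nat \<Rightarrow> nat" where r: "strict_mono r"
    and large: "\<And>i. \<not> norm (A (f (r i)) (g (r i))) < e"
    using infinite_enumerate by blast
  have "filterlim (\<lambda>i. f (r i)) at_top sequentially"
    "filterlim (\<lambda>i. g (r i)) at_top sequentially"
    using filterlim_compose[OF f filterlim_subseq[OF r]]
      filterlim_compose[OF g filterlim_subseq[OF r]] by simp_all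
  then obtain s where "(\<lambda>i. A (f (r (s i))) (g (r (s i)))) \<longlonglongrightarrow> 0"
    by (rule compact_entries_subseq_tendsto_0[OF p A])
  then have "\<forall>\<^sub>F i in sequentially. norm (A (f (r (s i))) (g (r (s i)))) < e"
    using e(1) by (auto simp: tendsto_iff)
  then obtain i where "norm (A (f (r (s i))) (g (r (s i)))) < e"
    by (rule eventually_happens'[OF sequentially_bot, THEN exE])
  then show False
    using large by (rule notE[rotated])
qed

section \<open>Toeplitz plus Hankel matrices\<close>

text \<open>A Hankel matrix has its symbol in its first column and in its first row. The column is in
  \<open>\<ell>\<^sup>p\<close>, which suffices for \<open>p < \<infinity>\<close>; for \<open>p = \<infinity>\<close> the row is summable.\<close>

lemma bounded_hankel_symbol_tendsto_0:
  assumes p: "1 \<le> p" and H: "generates_bounded p (hankel \<psi>)"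
  shows "\<psi> \<longlonglongrightarrow> 0"
proof -
  have "(\<lambda>n. \<psi> (n + 1)) \<longlonglongrightarrow> 0"
  proof (cases "p = \<infinity>")
    case True
    then show ?thesis
      using bounded_infinity_row_tendsto_0[of "hankel \<psi>" 0] H by (simp add: hankel_def)
  next
    case False
    have "(\<lambda>j. \<psi> (j + 1)) \<in> lp_space p"
      using bounded_column_in_lp[OF p H, of 0] by (simp add: hankel_def)
    with p False show ?thesis by (rule lp_space_tendsto_0)
  qed
  then show ?thesis by (rule LIMSEQ_offset)
qed

lemma compact_toeplitz_plus_hankel_periodic:
  assumes p: "1 \<le> p"
    and A: "generates_compact p (\<lambda>j k. toeplitz \<phi> j k + hankel \<psi> j k)"
  shows "\<phi> (n + 2) = \<phi> n"
proof -
  \<comment> \<open>The position \<open>(j + 1, k)\<close> lies on the \<open>n\<close>-th diagonal and not in the first column, so its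
    neighbour \<open>(j + 2, k - 1)\<close> on the same antidiagonal exists.\<close>
  define j k where "j = nat n" and "k = nat (- n) + 1"
  have n: "int j - int k = n - 1" by (simp add: j_def k_def)
  define a where "a m = \<psi> (j + k + 2 * m + 2)" for m
  have lim: "(\<lambda>m. toeplitz \<phi> (m + c) (m + d) + hankel \<psi> (m + c) (m + d)) \<longlonglongrightarrow> 0" for c d
    by (intro compact_entries_tendsto_0[OF p A] filterlim_add_const_nat_at_top)
  have "toeplitz \<phi> (m + (j + 1)) (m + k) + hankel \<psi> (m + (j + 1)) (m + k) = \<phi> n + a m"
    and "toeplitz \<phi> (m + (j + 2)) (m + (k - 1)) + hankel \<psi> (m + (j + 2)) (m + (k - 1))
      = \<phi> (n + 2) + a m" for m
  proof -
    have "int (m + (j + 1)) - int (m + k) = n" "int (m + (j + 2)) - int (m + (k - 1)) = n + 2"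
      "(m + (j + 1)) + (m + k) + 1 = j + k + 2 * m + 2"
      "(m + (j + 2)) + (m + (k - 1)) + 1 = j + k + 2 * m + 2"
      using n by (simp_all add: k_def)
    then show "toeplitz \<phi> (m + (j + 1)) (m + k) + hankel \<psi> (m + (j + 1)) (m + k) = \<phi> n + a m"
      and "toeplitz \<phi> (m + (j + 2)) (m + (k - 1)) + hankel \<psi> (m + (j + 2)) (m + (k - 1))
        = \<phi> (n + 2) + a m"
      unfolding toeplitz_def hankel_def a_def by (simp_all only:)
  qed
  then have "(\<lambda>m. \<phi> n + a m) \<longlonglongrightarrow> 0" "(\<lambda>m. \<phi> (n + 2) + a m) \<longlonglongrightarrow> 0"
    using lim[of "j + 1" k] lim[of "j + 2" "k - 1"] by (simp_all only:)
  from tendsto_diff[OF this(2,1)] show ?thesis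
    by (simp add: tendsto_const_iff[OF sequentially_bot])
qed

lemma periodic_even_diff:
  fixes \<phi> :: "int \<Rightarrow> 'a"
  assumes "\<And>n. \<phi> (n + 2) = \<phi> n" "even (m - n)"
  shows "\<phi> m = \<phi> n"
proof -
  have "\<phi> (n + 2 * int i) = \<phi> n" for n i
  proof (induction i)
    case (Suc i)
    then show ?case using assms(1)[of "n + 2 * int i"] by (simp add: algebra_simps)
  qed simp
  note up = this
  obtain d where d: "m = n + 2 * d"
    using assms(2) by (metis add_diff_cancel_left' add.commute diff_add_cancel evenE)
  show ?thesis
    using up[of n "nat d"] up[of m "nat (- d)"] by (cases "d \<ge> 0") (auto simp: d)
qed

theorem corollary8:
  fixes p :: ereal and \<phi> :: "int \<Rightarrow> complex" and \<psi> :: "nat \<Rightarrow> complex"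
  assumes "1 \<le> p"
    and "bounded (range \<phi>)"
    and "bounded (\<psi> ` {1..})"
    and "generates_compact p (\<lambda>j k. toeplitz \<phi> j k + hankel \<psi> j k)"
  shows "checkerboard (toeplitz \<phi>) \<and>
    (\<exists>\<psi>1 \<psi>2. compact_checkerboard_decomp p \<phi> \<psi> \<psi>1 \<psi>2 \<and>
       (\<forall>\<psi>1' \<psi>2'. compact_checkerboard_decomp p \<phi> \<psi> \<psi>1' \<psi>2' \<longrightarrow>
          (\<forall>n\<ge>1. \<psi>1' n = \<psi>1 n \<and> \<psi>2' n = \<psi>2 n)))"
proof -
  have parity: "\<phi> m = \<phi> n" if "even (m - n)" for m n
    using compact_toeplitz_plus_hankel_periodic[OF assms(1,4)] that
    by (rule periodic_even_diff)
  have cb: "checkerboard (toeplitz \<phi>)"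
    unfolding checkerboard_def toeplitz_def by (auto simp: of_nat_diff intro!: parity)
  define \<psi>2 where "\<psi>2 n = - \<phi> (int n - 1)" for n
  define \<psi>1 where "\<psi>1 n = \<psi> n - \<psi>2 n" for n
  have H2: "hankel \<psi>2 = (\<lambda>j k. - toeplitz \<phi> j k)"
    by (auto simp: fun_eq_iff hankel_def toeplitz_def \<psi>2_def intro!: parity)
  have H1: "hankel \<psi>1 = (\<lambda>j k. toeplitz \<phi> j k + hankel \<psi> j k)"
    using H2 by (simp add: fun_eq_iff hankel_def \<psi>1_def)
  then have compact: "generates_compact p (hankel \<psi>1)"
    using assms(4) by simp
  then have "\<psi>1 \<longlonglongrightarrow> 0"
    using bounded_hankel_symbol_tendsto_0[OF assms(1)] by (simp add: generates_compact_def)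
  with compact H2 have "compact_checkerboard_decomp p \<phi> \<psi> \<psi>1 \<psi>2"
    by (simp add: compact_checkerboard_decomp_def \<psi>1_def)
  moreover have "\<psi>1' n = \<psi>1 n \<and> \<psi>2' n = \<psi>2 n"
    if dec: "compact_checkerboard_decomp p \<phi> \<psi> \<psi>1' \<psi>2'" and n: "n \<ge> 1" for \<psi>1' \<psi>2' n
  proof -
    have "hankel \<psi>2' (n - 1) 0 = hankel \<psi>2 (n - 1) 0"
      using dec H2 by (simp add: compact_checkerboard_decomp_def)
    then have "\<psi>2' n = \<psi>2 n" using n by (simp add: hankel_def)
    moreover have "\<psi> n = \<psi>1' n + \<psi>2' n"
      using dec n by (simp add: compact_checkerboard_decomp_def)
    ultimately show ?thesis by (simp add: \<psi>1_def)
  qed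
  ultimately show ?thesis using cb by blast
qed

end
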